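(* Suppose every $f_i$ is convex, every $\Omega_i$ is nonempty, closed and convex, the graph $\mathcal G$ is connected, the matrix $\mathbf{L}=U^\top U$ satisfies the graph and null-space conditions given in the context, the solution set $\mathcal X^*$ of the resource allocation problem is nonempty, and the Slater condition in the context holds. Let $\beta_i>0$ and $c>0$ be such that $B-c\mathbf L\succ0$. Then, along the iterates of Mirror-P-EXTRA, the first-order optimality residual decays to $0$ at an $o(1/k)$ rate, i.e. $$\|U\widetilde\nabla\mathbf h(\mathbf x^{k+1})\|_{\mathrm F}^2=o\!\left(\tfrac1k\right),\qquad \|\mathbf x^{k+1}-\mathbf r+cU^\top\mathbf q^{k+1}\|_{\mathrm F}^2=o\!\left(\tfrac1k\right).$$
   Context: Problem. There are $n$ agents; agent $i$ has $f_i:\mathbb R^p\to\mathbb R$, a set $\Omega_i\subseteq\mathbb R^p$ and a vector $r_i\in\mathbb R^p$. The resource allocation problem is: minimize $\sum_{i=1}^n f_i(x_i)$ subject to $\sum_{i=1}^n(x_i-r_i)=0$ and $x_i\in\Omega_i$ for all $i$. Its solution set is $\mathcal X^*$. Points are written as matrices $\mathbf x\in\mathbb R^{n\times p}$ with $i$-th row $x_i^\top$; likewise $\mathbf r$ has rows $r_i^\top$. Let $h_i=f_i+g_i$, where $g_i$ is the indicator function of $\Omega_i$ ($0$ on $\Omega_i$, $+\infty$ outside). Slater condition: there is $\tilde{\mathbf x}$ satisfying $\sum_i(\tilde x_i-r_i)=0$ and lying in the relative interior of $\Omega_1\times\cdots\times\Omega_n$. Graph. $\mathcal G$ is a simple undirected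 graph on $\{1,\dots,n\}$ with edge set $\mathcal E$ and neighbor sets $\mathcal N_i$. The $n\times n$ matrix $\mathbf L=[L_{ij}]$ is compatible with $\mathcal G$ (that is, $L_{ij}=0$ whenever $i\ne j$ and $\{i,j\}\notin\mathcal E$) and $\mathbf L=U^\top U$ for some full-row-rank $U\in\mathbb R^{(n-1)\times n}$ with null space $\{a\mathbf 1: a\in\mathbb R\}$, where $\mathbf 1$ is the all-ones vector. Algorithm (Mirror-P-EXTRA). Each agent $i$ has $\beta_i>0$; all share $c>0$; $B=\mathrm{diag}(\beta_1,\dots,\beta_n)$. Initialize $x_i^0\in\Omega_i$, $s_i^0$ a subgradient of $f_i$ at $x_i^0$, $y_i^{-1}=0$. For $k=0,1,\dots$: $y_i^k=y_i^{k-1}+\sum_{j\in\mathcal N_i\cup\{i\}}L_{ij}s_j^k$; $x_i^{k+1}=\arg\min_{x_i\in\Omega_i}\{f_i(x_i)-\langle s_i^k,x_i\rangle+\frac1{2\beta_i}\|x_i-r_i+2cy_i^k-cy_i^{k-1}\|_2^2\}$; $s_i^{k+1}=s_i^k-\frac1{\beta_i}(x_i^{k+1}-r_i+2cy_i^k-cy_i^{k-1})$. Let $\widetilde\nabla\mathbf h(\mathbf x^k)$ denote the matrix with rows $(s_i^k)^\top$ (each $s_i^k$ is a subgradient of $h_i$ at $x_i^k$). Define $\mathbf q^{-1}=0$ and $\mathbf q^{k}=\mathbf q^{k-1}+U\widetilde\nabla\mathbf h(\mathbf x^k)$ for $k\ge0$. A nonnegative sequence $\{a_k\}$ is $o(1/k)$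 if $\limsup_{k\to\infty}ka_k=0$. $\|\cdot\|_{\mathrm F}$ is the Frobenius norm. *)

theory Defs
  imports "HOL-Analysis.Analysis" "HOL-Library.Landau_Symbols"
begin

text \<open>
  The agents are the elements of a finite type \<open>'n\<close>, so that \<open>n = CARD('n)\<close>, and a point of
  \<open>\<real>\<^sup>n\<^sup>\<times>\<^sup>p\<close> is a matrix of type \<open>real^'p^'n\<close> whose \<open>i\<close>-th row is \<open>x $ i\<close>.

  The matrix \<open>U\<close> has \<open>n - 1\<close> rows. Since this number is \<open>0\<close> for a single agent, and types are
  nonempty, its rows are indexed by natural numbers: \<open>U l\<close> is a row for \<open>l < n - 1\<close>, and the values
  of \<open>U\<close> at larger indices are irrelevant. The same holds for \<open>(n - 1) \<times> p\<close> matrices.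
\<close>

definition feasible_set :: "('n \<Rightarrow> (real^'p) set) \<Rightarrow> real^'p^'n \<Rightarrow> (real^'p^'n) set" where
  "feasible_set \<Omega> r = {x. (\<Sum>i\<in>UNIV. x $ i - r $ i) = 0 \<and> (\<forall>i. x $ i \<in> \<Omega> i)}"

definition solution_set ::
  "('n \<Rightarrow> real^'p \<Rightarrow> real) \<Rightarrow> ('n \<Rightarrow> (real^'p) set) \<Rightarrow> real^'p^'n \<Rightarrow> (real^'p^'n) set" where
  "solution_set f \<Omega> r =
     {x. is_arg_min (\<lambda>z. \<Sum>i\<in>UNIV. f i (z $ i)) (\<lambda>z. z \<in> feasible_set \<Omega> r) x}"

definition slater :: "('n \<Rightarrow> (real^'p) set) \<Rightarrow> real^'p^'n \<Rightarrow> bool" where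
  "slater \<Omega> r \<longleftrightarrow>
     (\<exists>z. (\<Sum>i\<in>UNIV. z $ i - r $ i) = 0 \<and> z \<in> rel_interior {x. \<forall>i. x $ i \<in> \<Omega> i})"

definition indicator_fun :: "'a set \<Rightarrow> 'a \<Rightarrow> ereal" where
  "indicator_fun S x = (if x \<in> S then 0 else \<infinity>)"

definition constrained :: "('a \<Rightarrow> real) \<Rightarrow> 'a set \<Rightarrow> 'a \<Rightarrow> ereal" where
  "constrained f S x = ereal (f x) + indicator_fun S x"

definition is_subgradient :: "('a::real_inner \<Rightarrow> ereal) \<Rightarrow> 'a \<Rightarrow> 'a \<Rightarrow> bool" where
  "is_subgradient F x s \<longleftrightarrow> \<bar>F x\<bar> \<noteq> \<infinity> \<and> (\<forall>y. F y \<ge> F x + ereal (s \<bullet> (y - x)))"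

definition simple_graph :: "'n set set \<Rightarrow> bool" where
  "simple_graph E \<longleftrightarrow> (\<forall>e\<in>E. \<exists>i j. i \<noteq> j \<and> e = {i, j})"

definition neighbors :: "'n set set \<Rightarrow> 'n \<Rightarrow> 'n set" where
  "neighbors E i = {j. j \<noteq> i \<and> {i, j} \<in> E}"

definition connected_graph :: "'n set set \<Rightarrow> bool" where
  "connected_graph E \<longleftrightarrow> (\<forall>i j. (i, j) \<in> {(u, v). v \<in> neighbors E u}\<^sup>*)"

definition graph_compatible :: "'n set set \<Rightarrow> real^'n^'n \<Rightarrow> bool" where
  "graph_compatible E L \<longleftrightarrow> (\<forall>i j. i \<noteq> j \<longrightarrow> {i, j} \<notin> E \<longrightarrow> L $ i $ j = 0)"

definition full_row_rank :: "(nat \<Rightarrow> real^'n) \<Rightarrow> bool" where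
  "full_row_rank U \<longleftrightarrow> dim (U ` {..<CARD('n) - 1}) = CARD('n) - 1"

definition row_null_space :: "(nat \<Rightarrow> real^'n) \<Rightarrow> (real^'n) set" where
  "row_null_space U = {v. \<forall>l<CARD('n) - 1. U l \<bullet> v = 0}"

definition gram :: "(nat \<Rightarrow> real^'n) \<Rightarrow> real^'n^'n" where
  "gram U = (\<chi> i j. \<Sum>l<CARD('n) - 1. U l $ i * U l $ j)"

definition diag :: "('n \<Rightarrow> real) \<Rightarrow> real^'n^'n" where
  "diag \<beta> = (\<chi> i j. if i = j then \<beta> i else 0)"

definition pos_def :: "real^'n^'n \<Rightarrow> bool" where
  "pos_def A \<longleftrightarrow> transpose A = A \<and> (\<forall>v. v \<noteq> 0 \<longrightarrow> v \<bullet> (A *v v) > 0)"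

definition mult_U :: "(nat \<Rightarrow> real^'n) \<Rightarrow> real^'p^'n \<Rightarrow> nat \<Rightarrow> real^'p" where
  "mult_U U x l = (\<Sum>j\<in>UNIV. (U l $ j) *\<^sub>R (x $ j))"

definition mult_U_transpose :: "(nat \<Rightarrow> real^'n) \<Rightarrow> (nat \<Rightarrow> real^'p) \<Rightarrow> real^'p^'n" where
  "mult_U_transpose U q = (\<chi> i. \<Sum>l<CARD('n) - 1. (U l $ i) *\<^sub>R q l)"

definition frobenius_norm :: "'i set \<Rightarrow> ('i \<Rightarrow> real^'p) \<Rightarrow> real" where
  "frobenius_norm I M = sqrt (\<Sum>l\<in>I. \<Sum>j\<in>UNIV. (M l $ j)\<^sup>2)"

lemma frobenius_norm_UNIV: "frobenius_norm UNIV (\<lambda>i. x $ i) = norm (x :: real^'p^'n)"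
  by (simp add: frobenius_norm_def norm_vec_def L2_set_def sum_nonneg)

text \<open>
  The sequences \<open>y\<close> and \<open>q\<close> start at the index \<open>-1\<close> and are therefore indexed by integers; their
  values at indices below \<open>-1\<close> play no role.
\<close>

definition mirror_P_EXTRA ::
  "('n \<Rightarrow> real^'p \<Rightarrow> real) \<Rightarrow> ('n \<Rightarrow> (real^'p) set) \<Rightarrow> real^'p^'n \<Rightarrow> 'n set set \<Rightarrow> real^'n^'n \<Rightarrow>
   ('n \<Rightarrow> real) \<Rightarrow> real \<Rightarrow>
   (nat \<Rightarrow> real^'p^'n) \<Rightarrow> (nat \<Rightarrow> real^'p^'n) \<Rightarrow> (int \<Rightarrow> real^'p^'n) \<Rightarrow> bool" where
  "mirror_P_EXTRA f \<Omega> r E L \<beta> c x s y \<longleftrightarrow>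
     (\<forall>i. x 0 $ i \<in> \<Omega> i \<and> is_subgradient (\<lambda>z. ereal (f i z)) (x 0 $ i) (s 0 $ i)
          \<and> y (-1) $ i = 0) \<and>
     (\<forall>k i. y (int k) $ i =
        y (int k - 1) $ i + (\<Sum>j\<in>neighbors E i \<union> {i}. (L $ i $ j) *\<^sub>R (s k $ j))) \<and>
     (\<forall>k i. is_arg_min
        (\<lambda>z. f i z - s k $ i \<bullet> z + 1 / (2 * \<beta> i) *
               (norm (z - r $ i + (2 * c) *\<^sub>R (y (int k) $ i) - c *\<^sub>R (y (int k - 1) $ i)))\<^sup>2)
        (\<lambda>z. z \<in> \<Omega> i) (x (Suc k) $ i)) \<and>
     (\<forall>k i. s (Suc k) $ i = s k $ i - (1 / \<beta> i) *\<^sub>R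
        (x (Suc k) $ i - r $ i + (2 * c) *\<^sub>R (y (int k) $ i) - c *\<^sub>R (y (int k - 1) $ i)))"

definition dual_sequence ::
  "(nat \<Rightarrow> real^'n) \<Rightarrow> (nat \<Rightarrow> real^'p^'n) \<Rightarrow> (int \<Rightarrow> nat \<Rightarrow> real^'p) \<Rightarrow> bool" where
  "dual_sequence U s q \<longleftrightarrow>
     (\<forall>l<CARD('n) - 1. q (-1) l = 0) \<and>
     (\<forall>k. \<forall>l<CARD('n) - 1. q (int k) l = q (int k - 1) l + mult_U U (s k) l)"

text \<open>
  The rows of \<open>s k\<close> are subgradients of \<open>f i\<close> plus the indicator function of \<open>\<Omega> i\<close> at the rows of
  \<open>x k\<close>, so that \<open>s k\<close> is the matrix of subgradients at the \<open>k\<close>-th iterate.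
\<close>

lemma constrained_subgradientI:
  assumes "x \<in> S" "\<And>y. y \<in> S \<Longrightarrow> f y \<ge> f x + s \<bullet> (y - x)"
  shows "is_subgradient (constrained f S) x s"
  using assms by (auto simp: is_subgradient_def constrained_def indicator_fun_def)

lemma prox_step_subgradient:
  fixes f :: "'a::real_inner \<Rightarrow> real"
  assumes f: "convex_on UNIV f" and S: "convex S" and b: "b > 0"
    and m: "is_arg_min (\<lambda>z. f z - s \<bullet> z + 1 / (2 * b) * (norm (z - r + u - v))\<^sup>2) (\<lambda>z. z \<in> S) x"
  shows "is_subgradient (constrained f S) x (s - (1 / b) *\<^sub>R (x - r + u - v))"
proof (rule constrained_subgradientI)
  show xS: "x \<in> S" using m by (simp add: is_arg_min_def)
  fix y assume y: "y \<in> S"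
  define w where "w = x - r + u - v"
  define d where "d = y - x"
  define A where "A = f y - f x - s \<bullet> d + (w \<bullet> d) / b"
  define C where "C = (d \<bullet> d) / (2 * b)"
  have "A + t * C \<ge> 0" if t: "0 < t" "t < 1" for t
  proof -
    have eq: "x + t *\<^sub>R d = (1 - t) *\<^sub>R x + t *\<^sub>R y"
      by (simp add: d_def algebra_simps)
    have S': "x + t *\<^sub>R d \<in> S"
      unfolding eq using S xS y t by (simp add: convex_alt)
    have w': "x + t *\<^sub>R d - r + u - v = w + t *\<^sub>R d"
      by (simp add: w_def)
    have nrm: "(norm (w + t *\<^sub>R d))\<^sup>2 = (norm w)\<^sup>2 + 2 * t * (w \<bullet> d) + t * t * (d \<bullet> d)"
      by (simp add: power2_norm_eq_inner inner_add_left inner_add_right inner_commute)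
    have "f x - s \<bullet> x + 1 / (2 * b) * (norm w)\<^sup>2 \<le>
        f (x + t *\<^sub>R d) - s \<bullet> (x + t *\<^sub>R d) + 1 / (2 * b) * (norm (w + t *\<^sub>R d))\<^sup>2"
      unfolding w'[symmetric] using m S' by (simp only: is_arg_min_linorder w_def)
    moreover have "f (x + t *\<^sub>R d) \<le> (1 - t) * f x + t * f y"
      unfolding eq using convex_onD[OF f, of t x y] t by simp
    moreover have "1 / (2 * b) * (norm (w + t *\<^sub>R d))\<^sup>2 =
        1 / (2 * b) * (norm w)\<^sup>2 + t * ((w \<bullet> d) / b) + t * (t * C)"
      unfolding nrm C_def using b by (simp add: field_simps)
    moreover have "s \<bullet> (x + t *\<^sub>R d) = s \<bullet> x + t * (s \<bullet> d)"
      by (simp add: inner_add_right)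
    moreover have "t * (A + t * C) =
        t * f y - t * f x - t * (s \<bullet> d) + t * ((w \<bullet> d) / b) + t * (t * C)"
      by (simp only: A_def distrib_left right_diff_distrib)
    moreover have "(1 - t) * f x = f x - t * f x"
      by (simp only: left_diff_distrib mult_1)
    ultimately have "0 \<le> t * (A + t * C)"
      by linarith
    then show ?thesis using t by (simp add: zero_le_mult_iff)
  qed
  then have "eventually (\<lambda>t. 0 \<le> A + t * C) (at_right 0)"
    unfolding eventually_at_right_field by (intro exI[of _ 1]) auto
  moreover have "((\<lambda>t. A + t * C) \<longlongrightarrow> A + 0 * C) (at_right 0)"
    by (intro tendsto_intros)
  ultimately have "0 \<le> A"
    using tendsto_lowerbound[of "\<lambda>t. A + t * C" "A + 0 * C" "at_right 0" 0] by simp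
  then show "f y \<ge> f x + (s - (1 / b) *\<^sub>R (x - r + u - v)) \<bullet> (y - x)"
    by (simp add: A_def d_def w_def[symmetric] inner_diff_left)
qed

lemma mirror_P_EXTRA_subgradient:
  assumes "mirror_P_EXTRA f \<Omega> r E L \<beta> c x s y"
    and "convex_on UNIV (f i)" "convex (\<Omega> i)" "\<beta> i > 0"
  shows "is_subgradient (constrained (f i) (\<Omega> i)) (x k $ i) (s k $ i)"
proof (cases k)
  case 0
  have "x 0 $ i \<in> \<Omega> i" "is_subgradient (\<lambda>z. ereal (f i z)) (x 0 $ i) (s 0 $ i)"
    using assms(1) by (auto simp: mirror_P_EXTRA_def)
  then show ?thesis unfolding 0
    by (intro constrained_subgradientI) (auto simp: is_subgradient_def)
next
  case (Suc k')
  have "is_arg_min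
        (\<lambda>z. f i z - s k' $ i \<bullet> z + 1 / (2 * \<beta> i) *
               (norm (z - r $ i + (2 * c) *\<^sub>R (y (int k') $ i) - c *\<^sub>R (y (int k' - 1) $ i)))\<^sup>2)
        (\<lambda>z. z \<in> \<Omega> i) (x (Suc k') $ i)"
    and s: "s (Suc k') $ i = s k' $ i - (1 / \<beta> i) *\<^sub>R
        (x (Suc k') $ i - r $ i + (2 * c) *\<^sub>R (y (int k') $ i) - c *\<^sub>R (y (int k' - 1) $ i))"
    using assms(1) unfolding mirror_P_EXTRA_def by blast+
  from prox_step_subgradient[OF assms(2,3,4) this(1)] show ?thesis
    unfolding Suc s .
qed

definition o_inverse_k :: "(nat \<Rightarrow> real) \<Rightarrow> bool" where
  "o_inverse_k a \<longleftrightarrow> (\<forall>k. a k \<ge> 0) \<and> limsup (\<lambda>k. ereal (real k * a k)) = 0"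

lemma o_inverse_k_iff_smallo:
  assumes "\<And>k. a k \<ge> 0"
  shows "o_inverse_k a \<longleftrightarrow> a \<in> o(\<lambda>k. 1 / real k)"
proof -
  have "a \<in> o(\<lambda>k. 1 / real k) \<longleftrightarrow> (\<lambda>k. a k / (1 / real k)) \<longlonglongrightarrow> 0"
  proof
    assume "(\<lambda>k. a k / (1 / real k)) \<longlonglongrightarrow> 0"
    then show "a \<in> o(\<lambda>k. 1 / real k)"
      by (rule smalloI_tendsto) (auto intro: eventually_mono[OF eventually_gt_at_top[of 0]])
  qed (rule smalloD_tendsto)
  also have "\<dots> \<longleftrightarrow> (\<lambda>k. real k * a k) \<longlonglongrightarrow> 0"
    by (simp add: mult.commute)
  also have "\<dots> \<longleftrightarrow> (\<lambda>k. ereal (real k * a k)) \<longlonglongrightarrow> 0"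
    by (simp only: zero_ereal_def lim_ereal)
  also have "\<dots> \<longleftrightarrow> limsup (\<lambda>k. ereal (real k * a k)) = 0"
  proof
    assume *: "limsup (\<lambda>k. ereal (real k * a k)) = 0"
    have "liminf (\<lambda>k. ereal (real k * a k)) \<ge> 0"
      using assms by (intro Liminf_bounded always_eventually) auto
    moreover have "liminf (\<lambda>k. ereal (real k * a k)) \<le> 0"
      using Liminf_le_Limsup[of sequentially "\<lambda>k. ereal (real k * a k)"] * by simp
    ultimately show "(\<lambda>k. ereal (real k * a k)) \<longlonglongrightarrow> 0"
      using * by (intro Liminf_eq_Limsup) auto
  qed (simp add: lim_imp_Limsup)
  finally show ?thesis using assms by (simp add: o_inverse_k_def)
qed

end

theory Submission
  imports Defs
begin

text \<open>
  Write \<open>M = diag \<beta> - c L\<close> and \<open>\<sigma>\<^sup>k = s\<^sup>0 + \<dots> + s\<^sup>k\<close>. Then \<open>q\<^sup>k = U \<sigma>\<^sup>k\<close> and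
  \<open>y\<^sup>k = U\<^sup>T q\<^sup>k = L \<sigma>\<^sup>k\<close>, and eliminating the extrapolated \<open>y\<close> from the update of \<open>s\<close> gives
  \<open>x\<^sup>k\<^sup>+\<^sup>1 - r + c L \<sigma>\<^sup>k\<^sup>+\<^sup>1 = - M (s\<^sup>k\<^sup>+\<^sup>1 - s\<^sup>k)\<close> (\<open>mirror_P_EXTRA_residual\<close>). Together with
  \<open>\<sigma>\<^sup>k\<^sup>+\<^sup>1 - \<sigma>\<^sup>k = s\<^sup>k\<^sup>+\<^sup>1\<close> this says that \<open>(s, \<sigma>)\<close> is a proximal point iteration for the optimality
  system of the dual problem in the semidefinite metric \<open>(M, c L)\<close>. Its squared steps are
  \<open>D\<^sup>k = \<langle>s\<^sup>k\<^sup>+\<^sup>1 - s\<^sup>k, M (s\<^sup>k\<^sup>+\<^sup>1 - s\<^sup>k)\<rangle> + c \<parallel>U s\<^sup>k\<^sup>+\<^sup>1\<parallel>\<^sup>2\<close>, and up to constants they dominate both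
  residuals: the second residual is \<open>M (s\<^sup>k\<^sup>+\<^sup>1 - s\<^sup>k)\<close>, whose norm is controlled by the form of \<open>M\<close>
  (\<open>semidefinite_norm_bound\<close>).

  Monotonicity of the subdifferentials, applied to consecutive iterates, makes \<open>D\<close> decreasing;
  applied to an iterate and a solution of the optimality system, it makes \<open>D\<close> summable
  (\<open>proximal_point_step_rate\<close>). A decreasing summable sequence is \<open>o(1/k)\<close>.

  It remains to solve the optimality system, that is, to find a minimiser \<open>x\<close>, a common subgradient
  of the constrained costs at its rows, and a \<open>\<sigma>\<close> with \<open>x - r + c L \<sigma> = 0\<close>. The subgradient is a
  Lagrange multiplier, which exists by the Slater condition and a supporting hyperplane
  (\<open>slater_lagrange_multiplier\<close>). The \<open>\<sigma>\<close> exists because the rows of \<open>x - r\<close> add up to \<open>0\<close>, so that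
  \<open>x - r\<close> is orthogonal to the kernel of the symmetric \<open>L\<close> (\<open>range_gram_mult\<close>). Working with \<open>\<sigma>\<close>
  instead of \<open>q\<close> keeps all the variables in the one space of \<open>n \<times> p\<close> matrices.
\<close>

section \<open>Rates of decreasing summable sequences\<close>

text \<open>The second half of the first \<open>n\<close> terms consists of at least \<open>n / 2\<close> terms that are at
  least \<open>a n\<close>, and its sum tends to \<open>0\<close> as a difference of two partial sums.\<close>

lemma decseq_summable_times_index_tendsto_0:
  fixes a :: "nat \<Rightarrow> real"
  assumes dec: "decseq a" and nonneg: "\<And>n. a n \<ge> 0" and sm: "summable a"
  shows "(\<lambda>n. real n * a n) \<longlonglongrightarrow> 0"
proof -
  define S where "S n = (\<Sum>j<n. a j)" for n
  have lim: "S \<longlonglongrightarrow> suminf a"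
    using summable_LIMSEQ[OF sm] by (simp add: S_def[abs_def])
  have half: "filterlim (\<lambda>n::nat. n div 2) sequentially sequentially"
    unfolding filterlim_at_top eventually_sequentially
    by (metis div_le_mono nonzero_mult_div_cancel_left zero_neq_numeral)
  have "(\<lambda>n. 2 * (S n - S (n div 2))) \<longlonglongrightarrow> 2 * (suminf a - suminf a)"
    by (intro tendsto_intros lim filterlim_compose[OF lim half])
  then have lim0: "(\<lambda>n. 2 * (S n - S (n div 2))) \<longlonglongrightarrow> 0" by simp
  have "real n * a n \<le> 2 * (S n - S (n div 2))" for n
  proof -
    have "real (card {n div 2..<n}) * a n \<le> (\<Sum>j\<in>{n div 2..<n}. a j)"
      using dec by (intro sum_bounded_below) (auto simp: decseq_def)
    also have "\<dots> = S n - S (n div 2)"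
      using sum_diff_nat_ivl[of 0 "n div 2" n a] by (simp add: S_def lessThan_atLeast0)
    finally have "2 * (real (n - n div 2) * a n) \<le> 2 * (S n - S (n div 2))" by simp
    moreover have "real n * a n \<le> (2 * real (n - n div 2)) * a n"
      using nonneg by (intro mult_right_mono) auto
    ultimately show ?thesis by (simp only: mult.assoc)
  qed
  then show ?thesis
    using nonneg by (intro tendsto_sandwich[OF _ _ tendsto_const lim0]) auto
qed

lemma o_inverse_k_bounded_by:
  assumes lim: "(\<lambda>k. real k * b k) \<longlonglongrightarrow> 0"
    and a: "\<And>k. 0 \<le> a k" "\<And>k. a k \<le> K * b k"
  shows "o_inverse_k a"
proof -
  have "(\<lambda>k. K * (real k * b k)) \<longlonglongrightarrow> K * 0"
    by (intro tendsto_intros lim)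
  then have lim': "(\<lambda>k. K * (real k * b k)) \<longlonglongrightarrow> 0" by simp
  have "(\<lambda>k. real k * a k) \<longlonglongrightarrow> 0"
  proof (rule tendsto_sandwich[OF _ _ tendsto_const lim'])
    show "\<forall>\<^sub>F k in sequentially. real k * a k \<le> K * (real k * b k)"
    proof (intro always_eventually allI)
      fix k
      have "real k * a k \<le> real k * (K * b k)"
        by (intro mult_left_mono a(2)) simp
      then show "real k * a k \<le> K * (real k * b k)" by (simp add: mult.left_commute)
    qed
  qed (use a(1) in auto)
  then have "(\<lambda>k. ereal (real k * a k)) \<longlonglongrightarrow> 0"
    by (simp only: zero_ereal_def lim_ereal)
  then show ?thesis
    using a(1) by (simp add: o_inverse_k_def lim_imp_Limsup)
qed


section \<open>The proximal point iteration in a semidefinite metric\<close>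

text \<open>The identity behind both energy estimates of the proximal point method: a nonpositive
  \<open>P\<close>-inner product of \<open>a\<close> and \<open>a - b\<close> turns the expansion of the square of \<open>b\<close> into a descent.\<close>

lemma semidefinite_descent:
  fixes P :: "'v::real_inner \<Rightarrow> 'v"
  assumes lin: "linear P" and self: "\<And>u v. u \<bullet> P v = P u \<bullet> v"
    and le: "a \<bullet> P (a - b) \<le> 0"
  shows "a \<bullet> P a + (a - b) \<bullet> P (a - b) \<le> b \<bullet> P b"
proof -
  have "a \<bullet> P b = b \<bullet> P a"
    by (simp add: self[of b a] inner_commute)
  then show ?thesis
    using le by (simp add: linear_diff[OF lin] inner_diff_left inner_diff_right)
qed

text \<open>The first hypothesis on \<open>z\<close> is the monotonicity inequality between an iterate and a zero of
  the operator; it makes the squared \<open>P\<close>-distance to the zero decrease by the squared step, so that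
  the squared steps are summable. The second one is the inequality between consecutive
  iterates; it makes the steps themselves shrink.\<close>

lemma proximal_point_step_rate:
  fixes P :: "'v::real_inner \<Rightarrow> 'v" and z :: "nat \<Rightarrow> 'v"
  assumes lin: "linear P" and self: "\<And>u v. u \<bullet> P v = P u \<bullet> v"
    and psd: "\<And>v. v \<bullet> P v \<ge> 0"
    and zero: "\<And>k. (z (Suc k) - w) \<bullet> P (z (Suc k) - z k) \<le> 0"
    and consecutive: "\<And>k. (z (Suc (Suc k)) - z (Suc k)) \<bullet>
        P ((z (Suc (Suc k)) - z (Suc k)) - (z (Suc k) - z k)) \<le> 0"
  shows "(\<lambda>k. real k * ((z (Suc k) - z k) \<bullet> P (z (Suc k) - z k))) \<longlonglongrightarrow> 0"
proof (rule decseq_summable_times_index_tendsto_0)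
  define D where "D k = (z (Suc k) - z k) \<bullet> P (z (Suc k) - z k)" for k
  define V where "V k = (z k - w) \<bullet> P (z k - w)" for k
  have D0: "D k \<ge> 0" and V0: "V k \<ge> 0" for k
    by (simp_all add: D_def V_def psd)
  have step: "V (Suc k) + D k \<le> V k" for k
    using semidefinite_descent[OF lin self, of "z (Suc k) - w" "z k - w"] zero[of k]
    by (simp add: V_def D_def)
  have sums: "(\<Sum>j<n. D j) \<le> V 0 - V n" for n
  proof (induction n)
    case (Suc n)
    then show ?case using step[of n] by simp
  qed simp
  have "summable D"
    using D0 by (rule bounded_imp_summable[where B = "V 0"])
      (metis sums V0 lessThan_Suc_atMost diff_le_eq le_add_same_cancel1 order_trans)
  then show "summable (\<lambda>k. (z (Suc k) - z k) \<bullet> P (z (Suc k) - z k))"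
    by (simp add: D_def[abs_def])
  show "decseq (\<lambda>k. (z (Suc k) - z k) \<bullet> P (z (Suc k) - z k))"
  proof (rule decseq_SucI)
    fix k
    show "(z (Suc (Suc k)) - z (Suc k)) \<bullet> P (z (Suc (Suc k)) - z (Suc k))
        \<le> (z (Suc k) - z k) \<bullet> P (z (Suc k) - z k)"
      using semidefinite_descent[OF lin self consecutive[of k]] psd by (smt (verit))
  qed
qed (rule psd)

text \<open>The form is nonnegative at \<open>v - t M v\<close>, as in the proof of Cauchy--Schwarz. If \<open>K\<close> bounds the
  operator norm of \<open>M\<close>, the step \<open>t = 1 / K\<close> loses at most half of the linear term to the
  quadratic one, which leaves \<open>t \<parallel>M v\<parallel>\<^sup>2 \<le> \<langle>v, M v\<rangle>\<close>.\<close>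

lemma semidefinite_norm_bound:
  fixes M :: "'v::euclidean_space \<Rightarrow> 'v"
  assumes lin: "linear M" and self: "\<And>u v. u \<bullet> M v = M u \<bullet> v"
    and psd: "\<And>v. v \<bullet> M v \<ge> 0"
  obtains K where "K > 0" "\<And>v. (norm (M v))\<^sup>2 \<le> K * (v \<bullet> M v)"
proof -
  obtain K where K: "K > 0" "\<And>v. norm (M v) \<le> K * norm v"
    using linear_bounded_pos[OF lin] by blast
  have "(norm (M v))\<^sup>2 \<le> K * (v \<bullet> M v)" for v
  proof -
    define w where "w = M v"
    define t where "t = 1 / K"
    have w2: "w \<bullet> w = (norm w)\<^sup>2" by (simp add: power2_norm_eq_inner)
    have "w \<bullet> M w \<le> norm w * norm (M w)" by (rule norm_cauchy_schwarz)
    also have "\<dots> \<le> norm w * (K * norm w)"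
      by (intro mult_left_mono K) auto
    finally have Qw: "w \<bullet> M w \<le> K * (norm w)\<^sup>2" by (simp add: power2_eq_square mult_ac)
    have "v \<bullet> M w = w \<bullet> w" by (simp add: self w_def)
    then have "(v - t *\<^sub>R w) \<bullet> M (v - t *\<^sub>R w) = v \<bullet> M v - 2 * t * (w \<bullet> w) + t * (t * (w \<bullet> M w))"
      by (simp add: linear_diff[OF lin] linear_scale[OF lin] inner_diff_left inner_diff_right
          w_def[symmetric] algebra_simps)
    moreover have "t * (t * (w \<bullet> M w)) \<le> t * (t * (K * (norm w)\<^sup>2))"
      using K(1) by (intro mult_left_mono Qw) (auto simp: t_def)
    moreover have "t * (t * (K * (norm w)\<^sup>2)) = t * (norm w)\<^sup>2"
      using K(1) by (simp add: t_def)
    ultimately have "t * (norm w)\<^sup>2 \<le> v \<bullet> M v"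
      using psd[of "v - t *\<^sub>R w"] unfolding w2 by linarith
    then show ?thesis using K(1) by (simp add: t_def w_def field_simps)
  qed
  with K(1) show ?thesis by (rule that)
qed

lemma self_adjoint_range:
  fixes T :: "'v::euclidean_space \<Rightarrow> 'v"
  assumes lin: "linear T" and self: "\<And>u v. u \<bullet> T v = T u \<bullet> v"
    and v: "\<And>u. T u = 0 \<Longrightarrow> u \<bullet> v = 0"
  shows "v \<in> range T"
proof -
  have adj: "adjoint T = T"
    by (rule adjoint_unique) (simp add: self)
  have "v \<in> (T -` {0})\<^sup>\<bottom>"
    using v by (auto simp: orthogonal_comp_def orthogonal_def)
  then have "v \<in> (range T)\<^sup>\<bottom>\<^sup>\<bottom>"
    using ker_orthogonal_comp_adjoint[OF lin] adj by simp
  then show ?thesis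
    using orthogonal_comp_self[of "range T"] linear_subspace_image[OF lin subspace_UNIV] by simp
qed


section \<open>A Lagrange multiplier under the relative interior Slater condition\<close>

text \<open>The set of pairs of a constraint residual \<open>A x - b\<close> and an upper bound of the excess cost
  \<open>g x - g x0\<close> is convex, and \<open>0\<close> is on its relative boundary because no feasible point has a
  negative excess. A supporting hyperplane there cannot be vertical: its functional would be
  nonnegative on the residuals and, as the Slater point is in the relative interior, vanish
  on them, so that the hyperplane would contain the whole set. The slope of the hyperplane
  is the multiplier.\<close>

lemma slater_lagrange_multiplier:
  fixes g :: "'a::euclidean_space \<Rightarrow> real" and A :: "'a \<Rightarrow> 'b::euclidean_space"
  assumes A: "linear A" and C: "convex C" and g: "convex_on C g"
    and x0: "x0 \<in> C" "A x0 = b" and opt: "\<And>x. x \<in> C \<Longrightarrow> A x = b \<Longrightarrow> g x0 \<le> g x"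
    and z: "z \<in> rel_interior C" "A z = b"
  obtains \<nu> where "\<And>x. x \<in> C \<Longrightarrow> g x0 + \<nu> \<bullet> (A x - b) \<le> g x"
proof -
  define W where "W = {(A x - b, t) | x t. x \<in> C \<and> g x - g x0 \<le> t}"
  have WI: "(A x - b, t) \<in> W" if "x \<in> C" "g x - g x0 \<le> t" for x t
    using that by (auto simp: W_def)
  have "convex W"
  proof (rule convexI)
    fix p p' :: "'b \<times> real" and u v :: real
    assume p: "p \<in> W" "p' \<in> W" and uv: "0 \<le> u" "0 \<le> v" "u + v = 1"
    from p obtain x t x' t' where *: "p = (A x - b, t)" "p' = (A x' - b, t')" "x \<in> C" "x' \<in> C"
        "g x - g x0 \<le> t" "g x' - g x0 \<le> t'"
      by (auto simp: W_def)
    have "g (u *\<^sub>R x + v *\<^sub>R x') \<le> u * g x + v * g x'"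
      using g * uv by (auto simp: convex_on_def)
    also have "\<dots> \<le> u * (t + g x0) + v * (t' + g x0)"
      using * uv by (intro add_mono mult_left_mono) auto
    also have "\<dots> = u * t + v * t' + (u + v) * g x0" by (simp add: algebra_simps)
    finally have 1: "g (u *\<^sub>R x + v *\<^sub>R x') - g x0 \<le> u * t + v * t'" using uv by simp
    have "A (u *\<^sub>R x + v *\<^sub>R x') - b = u *\<^sub>R A x + v *\<^sub>R A x' - (u + v) *\<^sub>R b"
      using uv by (simp add: linear_add[OF A] linear_scale[OF A])
    then have 2: "u *\<^sub>R p + v *\<^sub>R p' = (A (u *\<^sub>R x + v *\<^sub>R x') - b, u * t + v * t')"
      by (simp add: * algebra_simps)
    show "u *\<^sub>R p + v *\<^sub>R p' \<in> W"
      unfolding 2 using C * uv by (intro WI 1) (auto simp: convex_def)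
  qed
  have W0: "0 \<in> W"
    using WI[OF x0(1), of 0] x0(2) by (simp add: zero_prod_def)
  have W1: "(0, 1) \<in> W"
    using WI[OF x0(1), of 1] x0(2) by simp
  have "0 \<notin> rel_interior W"
  proof
    assume "0 \<in> rel_interior W"
    then obtain e where e: "e > 1" "(1 - e) *\<^sub>R (0, 1) + e *\<^sub>R 0 \<in> W"
      using convex_rel_interior_iff[of W 0] \<open>convex W\<close> W1 by blast
    then obtain x where "A x = b" "x \<in> C" "g x - g x0 \<le> 1 - e"
      by (auto simp: W_def zero_prod_def)
    then show False using opt[of x] e by simp
  qed
  then obtain a where a: "\<And>p. p \<in> W \<Longrightarrow> a \<bullet> 0 \<le> a \<bullet> p" "\<And>p. p \<in> rel_interior W \<Longrightarrow> a \<bullet> 0 < a \<bullet> p"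
    using supporting_hyperplane_rel_boundary[OF \<open>convex W\<close> W0] by metis
  obtain \<mu> \<tau> where mt: "a = (\<mu>, \<tau>)" by (cases a)
  have sup: "0 \<le> \<mu> \<bullet> (A x - b) + \<tau> * t" if "x \<in> C" "g x - g x0 \<le> t" for x t
    using a(1)[OF WI[OF that]] by (simp add: mt)
  have "\<tau> \<ge> 0" using a(1)[OF W1] by (simp add: mt)
  moreover have "\<tau> \<noteq> 0"
  proof
    assume t0: "\<tau> = 0"
    have nonneg: "0 \<le> \<mu> \<bullet> (A x - b)" if "x \<in> C" for x
      using sup[OF that order_refl] t0 by simp
    have "\<mu> \<bullet> (A x - b) = 0" if x: "x \<in> C" for x
    proof -
      obtain e where e: "e > 1" "(1 - e) *\<^sub>R x + e *\<^sub>R z \<in> C"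
        using convex_rel_interior_iff[of C z] C z(1) x by blast
      have "A ((1 - e) *\<^sub>R x + e *\<^sub>R z) = (1 - e) *\<^sub>R A x + e *\<^sub>R b"
        by (simp add: linear_add[OF A] linear_scale[OF A] z(2))
      then have "A ((1 - e) *\<^sub>R x + e *\<^sub>R z) - b = (1 - e) *\<^sub>R (A x - b)"
        by (simp add: algebra_simps)
      then have "0 \<le> (1 - e) * (\<mu> \<bullet> (A x - b))"
        using nonneg[OF e(2)] by simp
      then show ?thesis
        using nonneg[OF x] e(1) by (simp add: zero_le_mult_iff)
    qed
    then have "a \<bullet> p = 0" if "p \<in> W" for p
      using that t0 by (auto simp: W_def mt)
    moreover obtain p where "p \<in> rel_interior W"
      using rel_interior_eq_empty[OF \<open>convex W\<close>] W0 by blast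
    ultimately show False
      using a(2) rel_interior_subset by fastforce
  qed
  ultimately have "\<tau> > 0" by simp
  show ?thesis
  proof (rule that[of "- (1 / \<tau>) *\<^sub>R \<mu>"])
    fix x assume "x \<in> C"
    from sup[OF this order_refl] \<open>\<tau> > 0\<close>
    show "g x0 + (- (1 / \<tau>) *\<^sub>R \<mu>) \<bullet> (A x - b) \<le> g x"
      by (simp add: field_simps)
  qed
qed


section \<open>Matrices acting on matrices of rows\<close>

lemma linear_matrix_mult_left: "linear (\<lambda>X :: real^'p^'n. (A :: real^'n^'m) ** X)"
  by (rule linearI)
     (simp_all add: vec_eq_iff matrix_matrix_mult_def sum_distrib_left sum.distrib algebra_simps)

lemma matrix_mult_row: "(A ** X) $ i = (\<Sum>j\<in>UNIV. (A $ i $ j) *\<^sub>R (X $ j))"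
  for A :: "real^'n^'m" and X :: "real^'p^'n"
  by (simp add: vec_eq_iff matrix_matrix_mult_def)

lemma diag_mult_row: "(diag \<beta> ** X) $ i = \<beta> i *\<^sub>R (X $ i)"
  for X :: "real^'p^'n"
  by (simp add: matrix_mult_row diag_def if_distrib[of "\<lambda>a. a *\<^sub>R _"] cong: if_cong)

lemma inner_matrix_mult_columns:
  "X \<bullet> (A ** Y) = (\<Sum>j\<in>UNIV. column j X \<bullet> (A *v column j Y))"
  for A :: "real^'n^'n" and X Y :: "real^'p^'n"
proof -
  have "X \<bullet> (A ** Y) = (\<Sum>i\<in>UNIV. \<Sum>j\<in>UNIV. X $ i $ j * (\<Sum>k\<in>UNIV. A $ i $ k * Y $ k $ j))"
    by (simp add: inner_vec_def matrix_matrix_mult_def)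
  also have "\<dots> = (\<Sum>j\<in>UNIV. \<Sum>i\<in>UNIV. X $ i $ j * (\<Sum>k\<in>UNIV. A $ i $ k * Y $ k $ j))"
    by (rule sum.swap)
  finally show ?thesis
    by (simp add: inner_vec_def matrix_vector_mult_def column_def)
qed

lemma symmetric_matrix_mult_self_adjoint:
  fixes A :: "real^'n^'n" and X Y :: "real^'p^'n"
  assumes "transpose A = A"
  shows "X \<bullet> (A ** Y) = (A ** X) \<bullet> Y"
proof -
  have "u \<bullet> (A *v v) = v \<bullet> (A *v u)" for u v
    using assms by (metis dot_lmul_matrix inner_commute matrix_transpose_mul transpose_matrix_vector)
  then show ?thesis
    by (simp add: inner_matrix_mult_columns inner_commute[of "A ** X"])
qed

lemma pos_def_matrix_mult_nonneg:
  fixes A :: "real^'n^'n" and X :: "real^'p^'n"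
  assumes "pos_def A"
  shows "0 \<le> X \<bullet> (A ** X)"
proof -
  have "0 \<le> v \<bullet> (A *v v)" for v
    using assms by (cases "v = 0") (auto simp: pos_def_def less_imp_le)
  then show ?thesis
    by (simp add: inner_matrix_mult_columns sum_nonneg)
qed

lemma mult_U_transpose_mult_U: "mult_U_transpose U (mult_U U X) = gram U ** X"
  for X :: "real^'p^'n"
proof (subst vec_eq_iff, intro allI, subst vec_eq_iff, intro allI)
  fix i j
  have "mult_U_transpose U (mult_U U X) $ i $ j
      = (\<Sum>l<CARD('n) - 1. \<Sum>k\<in>UNIV. U l $ i * U l $ k * X $ k $ j)"
    by (simp add: mult_U_transpose_def mult_U_def sum_distrib_left mult.assoc)
  also have "\<dots> = (\<Sum>k\<in>UNIV. \<Sum>l<CARD('n) - 1. U l $ i * U l $ k * X $ k $ j)"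
    by (rule sum.swap)
  finally show "mult_U_transpose U (mult_U U X) $ i $ j = (gram U ** X) $ i $ j"
    by (simp add: gram_def matrix_matrix_mult_def sum_distrib_right)
qed

lemma inner_gram_mult:
  "X \<bullet> (gram U ** X) = (frobenius_norm {..<CARD('n) - 1} (mult_U U X))\<^sup>2"
  for X :: "real^'p^'n"
proof -
  have "X \<bullet> (gram U ** X) = (\<Sum>i\<in>UNIV. \<Sum>l<CARD('n) - 1. X $ i \<bullet> ((U l $ i) *\<^sub>R mult_U U X l))"
    unfolding mult_U_transpose_mult_U[symmetric]
    by (simp add: inner_vec_def[of X] mult_U_transpose_def inner_sum_right)
  also have "\<dots> = (\<Sum>l<CARD('n) - 1. \<Sum>i\<in>UNIV. X $ i \<bullet> ((U l $ i) *\<^sub>R mult_U U X l))"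
    by (rule sum.swap)
  also have "\<dots> = (\<Sum>l<CARD('n) - 1. mult_U U X l \<bullet> mult_U U X l)"
    by (intro sum.cong refl) (simp add: mult_U_def[of U X] inner_sum_left)
  finally show ?thesis
    by (simp add: frobenius_norm_def inner_vec_def power2_eq_square sum_nonneg)
qed

lemma transpose_gram: "transpose (gram U) = gram U"
  by (simp add: transpose_def gram_def vec_eq_iff mult.commute)

lemma gram_mult_constant_rows:
  assumes "row_null_space U = {a *\<^sub>R 1 | a :: real. True}"
  shows "gram U ** (\<chi> i. v) = (0 :: real^'p^'n)"
proof -
  have "1 \<in> row_null_space U"
    unfolding assms by (auto intro: exI[of _ 1])
  then have "mult_U U (\<chi> i. v) l = 0" if "l < CARD('n) - 1" for l
    using that
    by (simp add: row_null_space_def mult_U_def inner_vec_def flip: scaleR_sum_left)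
  then have "mult_U_transpose U (mult_U U (\<chi> i. v)) = 0"
    by (simp add: mult_U_transpose_def vec_eq_iff)
  then show ?thesis by (simp add: mult_U_transpose_mult_U)
qed

text \<open>The kernel of the Gram matrix is that of \<open>U\<close>, as the quadratic form is the squared norm of
  \<open>U X\<close>. It therefore consists of the matrices with equal rows, and the range of the Gram matrix
  is its orthogonal complement.\<close>

lemma range_gram_mult:
  fixes v :: "real^'p^'n"
  assumes null: "row_null_space U = {a *\<^sub>R 1 | a :: real. True}"
    and v: "(\<Sum>i\<in>UNIV. v $ i) = 0"
  obtains w where "v = gram U ** w"
proof -
  have "v \<in> range (\<lambda>X. gram U ** X)"
  proof (rule self_adjoint_range[OF linear_matrix_mult_left
        symmetric_matrix_mult_self_adjoint[OF transpose_gram]])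
    fix X :: "real^'p^'n" assume "gram U ** X = 0"
    then have "(\<Sum>l<CARD('n) - 1. \<Sum>j\<in>UNIV. (mult_U U X l $ j)\<^sup>2) = 0"
      using inner_gram_mult[of X U] by (simp add: frobenius_norm_def)
    then have "\<forall>l<CARD('n) - 1. \<forall>j. mult_U U X l $ j = 0"
      by (simp add: sum_nonneg_eq_0_iff sum_nonneg)
    then have "column j X \<in> row_null_space U" for j
      by (simp add: row_null_space_def mult_U_def inner_vec_def column_def)
    then have "\<forall>j. \<exists>a. column j X = a *\<^sub>R 1"
      unfolding null by blast
    then obtain a where "\<And>j. column j X = a j *\<^sub>R 1" by metis
    then have "column j X $ i = a j" for i j by simp
    then have "X $ i $ j = a j" for i j by (simp add: column_def)
    then have "X $ i = (\<chi> j. a j)" for i by (simp add: vec_eq_iff)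
    then show "X \<bullet> v = 0"
      using v by (simp add: inner_vec_def[of X] flip: inner_sum_right)
  qed
  then show ?thesis using that by blast
qed


section \<open>Optimality conditions of the resource allocation problem\<close>

lemma constrained_subgradientD:
  assumes "is_subgradient (constrained f S) x s"
  shows "x \<in> S" "y \<in> S \<Longrightarrow> f x + s \<bullet> (y - x) \<le> f y"
proof -
  show xS: "x \<in> S"
    using assms by (auto simp: is_subgradient_def constrained_def indicator_fun_def split: if_splits)
  show "f x + s \<bullet> (y - x) \<le> f y" if "y \<in> S"
    using assms xS that
    by (auto simp: is_subgradient_def constrained_def indicator_fun_def dest!: spec[of _ y])
qed

lemma constrained_subgradient_monotone:
  fixes f :: "'a::real_inner \<Rightarrow> real"
  assumes "is_subgradient (constrained f S) x s" "is_subgradient (constrained f S) x' s'"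
  shows "0 \<le> (x - x') \<bullet> (s - s')"
proof -
  have "f x + s \<bullet> (x' - x) \<le> f x'" "f x' + s' \<bullet> (x - x') \<le> f x"
    using assms constrained_subgradientD by blast+
  then show ?thesis
    by (simp add: inner_diff_left inner_diff_right inner_commute)
qed

text \<open>The Lagrangian of the problem splits over the agents. Since a multiplier makes a solution
  minimise it over the product of the sets \<open>\<Omega> i\<close>, changing a single row at a time shows
  that the multiplier is a common subgradient of all the constrained costs.\<close>

lemma resource_allocation_multiplier:
  fixes f :: "'n::finite \<Rightarrow> real^'p \<Rightarrow> real"
  assumes f: "\<And>i. convex_on UNIV (f i)" and \<Omega>: "\<And>i. convex (\<Omega> i)"
    and sol: "x \<in> solution_set f \<Omega> r" and slat: "slater \<Omega> r"
  obtains \<nu> where "\<And>i. is_subgradient (constrained (f i) (\<Omega> i)) (x $ i) \<nu>"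
proof -
  define C where "C = {z :: real^'p^'n. \<forall>i. z $ i \<in> \<Omega> i}"
  define g where "g z = (\<Sum>i\<in>UNIV. f i (z $ i))" for z :: "real^'p^'n"
  define A where "A z = (\<Sum>i\<in>UNIV. z $ i)" for z :: "real^'p^'n"
  have "linear A"
    by (rule linearI) (simp_all add: A_def sum.distrib scaleR_sum_right)
  have "convex C"
    unfolding convex_def C_def
  proof (intro ballI allI impI CollectI)
    fix X Y :: "real^'p^'n" and u v :: real and i
    assume "X \<in> {z. \<forall>i. z $ i \<in> \<Omega> i}" "Y \<in> {z. \<forall>i. z $ i \<in> \<Omega> i}" "0 \<le> u" "0 \<le> v" "u + v = 1"
    then show "(u *\<^sub>R X + v *\<^sub>R Y) $ i \<in> \<Omega> i"
      using \<Omega>[of i] by (simp add: convexD)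
  qed
  moreover have "convex_on C g"
    unfolding convex_on_def
  proof (intro conjI ballI allI impI \<open>convex C\<close>)
    fix X Y :: "real^'p^'n" and u v :: real
    assume uv: "0 \<le> u" "0 \<le> v" "u + v = 1"
    have "f i (u *\<^sub>R X $ i + v *\<^sub>R Y $ i) \<le> u * f i (X $ i) + v * f i (Y $ i)" for i
      using f[of i] uv by (auto simp: convex_on_def)
    then show "g (u *\<^sub>R X + v *\<^sub>R Y) \<le> u * g X + v * g Y"
      by (simp add: g_def sum_distrib_left sum_mono flip: sum.distrib)
  qed
  moreover have xC: "x \<in> C" and Ax: "A x = A r"
    and "\<And>y. y \<in> C \<Longrightarrow> A y = A r \<Longrightarrow> g x \<le> g y"
    using sol
    by (auto simp: solution_set_def feasible_set_def is_arg_min_linorder C_def A_def g_def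
        sum_subtractf)
  moreover obtain z where "z \<in> rel_interior C" "A z = A r"
    using slat by (auto simp: slater_def C_def A_def sum_subtractf)
  ultimately obtain \<nu> where \<nu>: "\<And>y. y \<in> C \<Longrightarrow> g x + \<nu> \<bullet> (A y - A r) \<le> g y"
    using slater_lagrange_multiplier[OF \<open>linear A\<close>] by metis
  show ?thesis
  proof (rule that, rule constrained_subgradientI)
    fix i
    show "x $ i \<in> \<Omega> i" using xC by (simp add: C_def)
    fix v assume v: "v \<in> \<Omega> i"
    define y where "y = (\<chi> j. if j = i then v else x $ j)"
    have "y \<in> C" using xC v by (simp add: C_def y_def)
    moreover have "A y - A x = (\<Sum>j\<in>UNIV. if j = i then v - x $ i else 0)"
      unfolding A_def sum_subtractf[symmetric] by (intro sum.cong) (auto simp: y_def)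
    then have "A y - A r = v - x $ i" using Ax by simp
    moreover have "g y - g x = (\<Sum>j\<in>UNIV. if j = i then f i v - f i (x $ i) else 0)"
      unfolding g_def sum_subtractf[symmetric] by (intro sum.cong) (auto simp: y_def)
    then have "g y - g x = f i v - f i (x $ i)" by simp
    ultimately show "f i (x $ i) + \<nu> \<bullet> (v - x $ i) \<le> f i v"
      using \<nu>[of y] by simp
  qed
qed


section \<open>Mirror-P-EXTRA as a proximal point iteration\<close>

text \<open>Both dual sequences are images of the partial sums of the subgradients, \<open>q\<close> under \<open>U\<close> and
  \<open>y\<close> under \<open>L\<close>, whence \<open>y = U\<^sup>T q\<close>.\<close>

lemma mirror_P_EXTRA_y:
  fixes s :: "nat \<Rightarrow> real^'p^'n"
  assumes alg: "mirror_P_EXTRA f \<Omega> r E L \<beta> c x s y" and L: "graph_compatible E L"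
  shows "y (int k) = L ** (\<Sum>j\<le>k. s j)"
proof -
  have rec: "y (int k) = y (int k - 1) + L ** s k" for k
  proof (subst vec_eq_iff, intro allI)
    fix i
    have "(\<Sum>j\<in>neighbors E i \<union> {i}. (L $ i $ j) *\<^sub>R (s k $ j)) = (L ** s k) $ i"
      unfolding matrix_mult_row
    proof (rule sum.mono_neutral_left)
      have "L $ i $ j = 0" if "j \<notin> neighbors E i \<union> {i}" for j
      proof -
        from that have "i \<noteq> j" "{i, j} \<notin> E" by (auto simp: neighbors_def)
        then show ?thesis using L unfolding graph_compatible_def by blast
      qed
      then show "\<forall>j\<in>UNIV - (neighbors E i \<union> {i}). (L $ i $ j) *\<^sub>R (s k $ j) = 0"
        by simp
    qed simp_all
    then show "y (int k) $ i = (y (int k - 1) + L ** s k) $ i"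
      using alg by (simp add: mirror_P_EXTRA_def)
  qed
  have "y (- 1) = 0"
    using alg by (simp add: mirror_P_EXTRA_def vec_eq_iff)
  then show ?thesis
    by (induction k) (use rec[of 0] rec[of "Suc _"] in \<open>simp_all add: matrix_add_ldistrib\<close>)
qed

lemma dual_sequence_mult_U_transpose:
  fixes s :: "nat \<Rightarrow> real^'p^'n"
  assumes "dual_sequence U s q"
  shows "mult_U_transpose U (q (int k)) = gram U ** (\<Sum>j\<le>k. s j)"
proof -
  have rec: "q (int k) l = q (int k - 1) l + mult_U U (s k) l" if "l < CARD('n) - 1" for k l
    using assms that by (simp add: dual_sequence_def)
  have "q (int k) l = mult_U U (\<Sum>j\<le>k. s j) l" if l: "l < CARD('n) - 1" for l
  proof (induction k)
    case 0
    show ?case using rec[OF l, of 0] assms l by (simp add: dual_sequence_def)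
  next
    case (Suc k)
    then show ?case using rec[OF l, of "Suc k"]
      by (simp add: mult_U_def scaleR_add_right sum.distrib)
  qed
  then have "mult_U_transpose U (q (int k)) = mult_U_transpose U (mult_U U (\<Sum>j\<le>k. s j))"
    by (simp add: mult_U_transpose_def)
  then show ?thesis by (simp add: mult_U_transpose_mult_U)
qed

text \<open>The extrapolation \<open>2 y\<^sup>k - y\<^sup>k\<^sup>-\<^sup>1\<close> differs from \<open>y\<^sup>k\<^sup>+\<^sup>1\<close> by \<open>L\<close> applied to the subgradient
  increment, so the update is implicit in the dual variable, and the correction is absorbed
  by passing from the metric \<open>diag \<beta>\<close> to \<open>diag \<beta> - c L\<close>.\<close>

lemma mirror_P_EXTRA_residual:
  fixes s :: "nat \<Rightarrow> real^'p^'n"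
  assumes alg: "mirror_P_EXTRA f \<Omega> r E L \<beta> c x s y" and L: "graph_compatible E L"
    and \<beta>: "\<And>i. \<beta> i > 0"
  shows "x (Suc k) - r + c *\<^sub>R (L ** (\<Sum>j\<le>Suc k. s j))
    = - ((diag \<beta> - c *\<^sub>R L) ** (s (Suc k) - s k))"
proof -
  define Y where "Y = L ** (\<Sum>j\<le>k. s j)"
  have yk: "y (int k) = Y"
    unfolding Y_def by (rule mirror_P_EXTRA_y[OF alg L])
  have "y (int k) = y (int k - 1) + L ** s k"
  proof (cases k)
    case 0
    have "y (- 1) = 0"
      using alg by (simp add: mirror_P_EXTRA_def vec_eq_iff)
    then show ?thesis using mirror_P_EXTRA_y[OF alg L, of 0] 0 by simp
  next
    case (Suc k')
    then show ?thesis
      using mirror_P_EXTRA_y[OF alg L, of k'] mirror_P_EXTRA_y[OF alg L, of k]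
      by (simp add: matrix_add_ldistrib)
  qed
  then have yp: "y (int k - 1) = Y - L ** s k" using yk by simp
  have B: "diag \<beta> ** (s (Suc k) - s k)
      = - (x (Suc k) - r + (2 * c) *\<^sub>R Y - c *\<^sub>R (Y - L ** s k))"
  proof (subst vec_eq_iff, intro allI)
    fix i
    have "s (Suc k) $ i = s k $ i - (1 / \<beta> i) *\<^sub>R
        (x (Suc k) $ i - r $ i + (2 * c) *\<^sub>R (y (int k) $ i) - c *\<^sub>R (y (int k - 1) $ i))"
      using alg unfolding mirror_P_EXTRA_def by blast
    then have "s (Suc k) $ i - s k $ i = - ((1 / \<beta> i) *\<^sub>R
        (x (Suc k) $ i - r $ i + (2 * c) *\<^sub>R (Y $ i) - c *\<^sub>R ((Y - L ** s k) $ i)))"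
      unfolding yk yp by simp
    then have "\<beta> i *\<^sub>R (s (Suc k) $ i - s k $ i) =
        - (x (Suc k) $ i - r $ i + (2 * c) *\<^sub>R (Y $ i) - c *\<^sub>R ((Y - L ** s k) $ i))"
      using \<beta>[of i] by simp
    then show "(diag \<beta> ** (s (Suc k) - s k)) $ i =
        (- (x (Suc k) - r + (2 * c) *\<^sub>R Y - c *\<^sub>R (Y - L ** s k))) $ i"
      by (simp add: diag_mult_row)
  qed
  have diffs: "L ** (s (Suc k) - s k) = L ** s (Suc k) - L ** s k"
    by (rule linear_diff[OF linear_matrix_mult_left])
  have "(diag \<beta> - c *\<^sub>R L) ** (s (Suc k) - s k)
      = diag \<beta> ** (s (Suc k) - s k) - c *\<^sub>R (L ** (s (Suc k) - s k))"
    by (simp add: vec_eq_iff matrix_matrix_mult_def sum_subtractf sum.distrib sum_distrib_left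
        algebra_simps)
  moreover have "L ** (\<Sum>j\<le>Suc k. s j) = Y + L ** s (Suc k)"
    by (simp add: Y_def matrix_add_ldistrib)
  ultimately show ?thesis
    unfolding B diffs by (simp add: vec_eq_iff algebra_simps)
qed

text \<open>The pairs of the subgradients \<open>s\<close> and their partial sums \<open>\<sigma>\<close> form a proximal point
  iteration in the metric \<open>(u, v) \<mapsto> (M u, c L v)\<close>, and the triple of \<open>x'\<close>, \<open>s'\<close> and \<open>\<sigma>'\<close>
  solves the optimality system. The factor of \<open>real k\<close> in the conclusion is the squared step of
  this iteration.\<close>

lemma primal_dual_step_rate:
  fixes M L :: "'a::real_inner \<Rightarrow> 'a" and x s \<sigma> :: "nat \<Rightarrow> 'a"
  assumes M: "linear M" "\<And>u v. u \<bullet> M v = M u \<bullet> v" "\<And>v. v \<bullet> M v \<ge> 0"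
    and L: "linear L" "\<And>u v. u \<bullet> L v = L u \<bullet> v" "\<And>v. v \<bullet> L v \<ge> 0"
    and c: "c \<ge> 0"
    and step: "\<And>k. x (Suc k) - r + c *\<^sub>R L (\<sigma> (Suc k)) = - M (s (Suc k) - s k)"
    and \<sigma>: "\<And>k. \<sigma> (Suc k) = \<sigma> k + s (Suc k)"
    and mono: "\<And>j k. 0 \<le> (x j - x k) \<bullet> (s j - s k)"
    and opt: "L s' = 0" "x' - r + c *\<^sub>R L \<sigma>' = 0" "\<And>k. 0 \<le> (x k - x') \<bullet> (s k - s')"
  shows "(\<lambda>k. real k * ((s (Suc k) - s k) \<bullet> M (s (Suc k) - s k)
      + c * (s (Suc k) \<bullet> L (s (Suc k))))) \<longlonglongrightarrow> 0"
proof -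
  define P where "P z = (M (fst z), c *\<^sub>R L (snd z))" for z
  define z where "z k = (s k, \<sigma> k)" for k
  define w where "w = (s', \<sigma>')"
  have "(\<lambda>k. real k * ((z (Suc k) - z k) \<bullet> P (z (Suc k) - z k))) \<longlonglongrightarrow> 0"
  proof (rule proximal_point_step_rate)
    show "linear P"
      by (rule linearI) (simp_all add: P_def linear_add[OF M(1)] linear_add[OF L(1)]
          linear_scale[OF M(1)] linear_scale[OF L(1)] scaleR_add_right)
    show "u \<bullet> P v = P u \<bullet> v" for u v
      by (simp add: P_def inner_prod_def M(2) L(2))
    show "v \<bullet> P v \<ge> 0" for v
      using M(3) L(3) c by (simp add: P_def inner_prod_def)
    show "(z (Suc k) - w) \<bullet> P (z (Suc k) - z k) \<le> 0" for k
    proof -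
      have "x (Suc k) - x' = - M (s (Suc k) - s k) - c *\<^sub>R L (\<sigma> (Suc k) - \<sigma>')"
        using step[of k] opt(2) by (simp add: linear_diff[OF L(1)] algebra_simps)
      moreover have "L (\<sigma> (Suc k) - \<sigma>') \<bullet> (s (Suc k) - s')
          = (\<sigma> (Suc k) - \<sigma>') \<bullet> L (s (Suc k))"
        unfolding L(2)[symmetric] using opt(1) by (simp add: linear_diff[OF L(1)])
      ultimately have "(x (Suc k) - x') \<bullet> (s (Suc k) - s') =
          - (M (s (Suc k) - s k) \<bullet> (s (Suc k) - s')) - c * ((\<sigma> (Suc k) - \<sigma>') \<bullet> L (s (Suc k)))"
        by (simp only: inner_diff_left[of _ _ "s (Suc k) - s'"] inner_minus_left inner_scaleR_left)
      also have "\<dots> = - ((z (Suc k) - w) \<bullet> P (z (Suc k) - z k))"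
        by (simp add: z_def w_def P_def \<sigma> inner_commute[of "s (Suc k) - s'"])
      finally show ?thesis using opt(3)[of "Suc k"] by simp
    qed
    show "(z (Suc (Suc k)) - z (Suc k)) \<bullet>
        P ((z (Suc (Suc k)) - z (Suc k)) - (z (Suc k) - z k)) \<le> 0" for k
    proof -
      define d where "d = s (Suc (Suc k)) - s (Suc k)"
      define e where "e = s (Suc k) - s k"
      have "x (Suc (Suc k)) - x (Suc k) = - M (d - e) - c *\<^sub>R L (s (Suc (Suc k)))"
      proof -
        have "x (Suc k) = r - c *\<^sub>R L (\<sigma> (Suc k)) - M e"
          using step[of k] by (simp add: e_def algebra_simps)
        moreover have "x (Suc (Suc k)) = r - c *\<^sub>R L (\<sigma> (Suc (Suc k))) - M d"
          using step[of "Suc k"] by (simp add: d_def algebra_simps)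
        ultimately show ?thesis
          by (simp add: \<sigma>[of "Suc k"] linear_diff[OF M(1)] linear_add[OF L(1)] scaleR_add_right)
      qed
      moreover have "L (s (Suc (Suc k))) \<bullet> d = s (Suc (Suc k)) \<bullet> L d"
        by (rule L(2)[symmetric])
      ultimately have "(x (Suc (Suc k)) - x (Suc k)) \<bullet> d
          = - (M (d - e) \<bullet> d) - c * (s (Suc (Suc k)) \<bullet> L d)"
        by (simp only: inner_diff_left[of _ _ d] inner_minus_left inner_scaleR_left)
      also have "\<dots> = - ((d, s (Suc (Suc k))) \<bullet> P (d - e, d))"
        by (simp add: P_def inner_commute[of d])
      also have "(d, s (Suc (Suc k))) = z (Suc (Suc k)) - z (Suc k)"
        by (simp add: z_def d_def \<sigma>)
      also have "(d - e, d) = (z (Suc (Suc k)) - z (Suc k)) - (z (Suc k) - z k)"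
        by (simp add: z_def d_def e_def \<sigma>)
      finally show ?thesis using mono[of "Suc (Suc k)" "Suc k"] by (simp add: d_def)
    qed
  qed
  then show ?thesis
    by (simp add: z_def P_def \<sigma>)
qed

theorem theorem2:
  fixes f :: "'n::finite \<Rightarrow> real^'p \<Rightarrow> real"
    and \<Omega> :: "'n \<Rightarrow> (real^'p) set"
    and r :: "real^'p^'n"
    and E :: "'n set set"
    and L :: "real^'n^'n"
    and U :: "nat \<Rightarrow> real^'n"
    and \<beta> :: "'n \<Rightarrow> real"
    and c :: real
    and x s :: "nat \<Rightarrow> real^'p^'n"
    and y :: "int \<Rightarrow> real^'p^'n"
    and q :: "int \<Rightarrow> nat \<Rightarrow> real^'p"
  assumes "\<And>i. convex_on UNIV (f i)"
    and "\<And>i. \<Omega> i \<noteq> {}" and "\<And>i. closed (\<Omega> i)" and "\<And>i. convex (\<Omega> i)"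
    and "simple_graph E" and "connected_graph E"
    and "graph_compatible E L"
    and "L = gram U" and "full_row_rank U"
    and "row_null_space U = {a *\<^sub>R 1 | a :: real. True}"
    and "solution_set f \<Omega> r \<noteq> {}"
    and "slater \<Omega> r"
    and "\<And>i. \<beta> i > 0" and "c > 0"
    and "pos_def (diag \<beta> - c *\<^sub>R L)"
    and "mirror_P_EXTRA f \<Omega> r E L \<beta> c x s y"
    and "dual_sequence U s q"
  shows "o_inverse_k (\<lambda>k. (frobenius_norm {..<CARD('n) - 1} (mult_U U (s (k + 1))))\<^sup>2)
       \<and> o_inverse_k (\<lambda>k. (frobenius_norm UNIV
           (\<lambda>i. (x (k + 1) - r + c *\<^sub>R mult_U_transpose U (q (int (k + 1)))) $ i))\<^sup>2)"
proof -
  note f = assms(1) and \<Omega> = assms(4) and compat = assms(7) and L = assms(8)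
    and null = assms(10) and \<beta> = assms(13) and c = assms(14) and pd = assms(15) and alg = assms(16)
  define M where "M X = (diag \<beta> - c *\<^sub>R L) ** X" for X :: "real^'p^'n"
  define \<sigma> where "\<sigma> k = (\<Sum>j\<le>k. s j)" for k
  have M: "linear M" "\<And>u v. u \<bullet> M v = M u \<bullet> v" "\<And>v. v \<bullet> M v \<ge> 0"
    unfolding M_def using pd
    by (auto intro: linear_matrix_mult_left symmetric_matrix_mult_self_adjoint
        pos_def_matrix_mult_nonneg simp: pos_def_def)
  have step: "x (Suc k) - r + c *\<^sub>R (L ** \<sigma> (Suc k)) = - M (s (Suc k) - s k)" for k
    unfolding M_def \<sigma>_def by (rule mirror_P_EXTRA_residual[OF alg compat \<beta>])
  have sub: "is_subgradient (constrained (f i) (\<Omega> i)) (x k $ i) (s k $ i)" for k i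
    by (rule mirror_P_EXTRA_subgradient[OF alg f \<Omega> \<beta>])

  obtain x0 where x0: "x0 \<in> solution_set f \<Omega> r" using assms(11) by blast
  obtain \<nu> where \<nu>: "\<And>i. is_subgradient (constrained (f i) (\<Omega> i)) (x0 $ i) \<nu>"
    using resource_allocation_multiplier[OF f \<Omega> x0 assms(12)] by blast
  have "(\<Sum>i\<in>UNIV. (- (1 / c) *\<^sub>R (x0 - r)) $ i) = - (1 / c) *\<^sub>R (\<Sum>i\<in>UNIV. x0 $ i - r $ i)"
    by (simp add: scaleR_sum_right sum_negf)
  also have "\<dots> = 0"
    using x0 by (simp add: solution_set_def is_arg_min_def feasible_set_def)
  finally obtain \<sigma>0 where "- (1 / c) *\<^sub>R (x0 - r) = L ** \<sigma>0"
    using range_gram_mult[OF null] L by metis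
  then have "c *\<^sub>R (L ** \<sigma>0) = - (x0 - r)"
    using c by (metis (no_types, lifting) divide_self_if less_irrefl mult_minus_right
        scaleR_minus_left scaleR_one scaleR_scaleR times_divide_eq_right mult.right_neutral)
  then have opt: "x0 - r + c *\<^sub>R (L ** \<sigma>0) = 0" by simp

  define D where "D k = (s (Suc k) - s k) \<bullet> M (s (Suc k) - s k)
      + c * (s (Suc k) \<bullet> (L ** s (Suc k)))" for k
  have Ds: "c * (s (Suc k) \<bullet> (L ** s (Suc k))) \<le> D k"
    and DM: "(s (Suc k) - s k) \<bullet> M (s (Suc k) - s k) \<le> D k" for k
    using M(3) c by (simp_all add: D_def L inner_gram_mult)
  have rate: "(\<lambda>k. real k * D k) \<longlonglongrightarrow> 0"
    unfolding D_def
  proof (rule primal_dual_step_rate[OF M, where \<sigma> = \<sigma> and s' = "\<chi> i. \<nu>"])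
    show "linear (\<lambda>X :: real^'p^'n. L ** X)" by (rule linear_matrix_mult_left)
    show "u \<bullet> (L ** v) = (L ** u) \<bullet> v" for u v :: "real^'p^'n"
      unfolding L by (rule symmetric_matrix_mult_self_adjoint[OF transpose_gram])
    show "0 \<le> v \<bullet> (L ** v)" for v :: "real^'p^'n"
      by (simp add: L inner_gram_mult)
    show "L ** (\<chi> i. \<nu>) = (0 :: real^'p^'n)"
      unfolding L by (rule gram_mult_constant_rows[OF null])
    show "\<sigma> (Suc k) = \<sigma> k + s (Suc k)" for k by (simp add: \<sigma>_def)
    show "0 \<le> (x j - x k) \<bullet> (s j - s k)" for j k
      unfolding inner_vec_def[of "x j - x k"] using constrained_subgradient_monotone[OF sub sub]
      by (simp add: sum_nonneg)
    show "0 \<le> (x k - x0) \<bullet> (s k - (\<chi> i. \<nu>))" for k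
      unfolding inner_vec_def[of "x k - x0"] using constrained_subgradient_monotone[OF sub \<nu>]
      by (simp add: sum_nonneg)
  qed (use c step opt in auto)

  obtain K where K: "K > 0" "\<And>v. (norm (M v))\<^sup>2 \<le> K * (v \<bullet> M v)"
    using semidefinite_norm_bound[OF M] by blast
  have "o_inverse_k (\<lambda>k. (frobenius_norm {..<CARD('n) - 1} (mult_U U (s (k + 1))))\<^sup>2)"
  proof (rule o_inverse_k_bounded_by[OF rate])
    fix k
    show "(frobenius_norm {..<CARD('n) - 1} (mult_U U (s (k + 1))))\<^sup>2 \<le> 1 / c * D k"
      using Ds[of k] c by (simp add: L inner_gram_mult field_simps)
  qed simp
  moreover have "o_inverse_k (\<lambda>k. (frobenius_norm UNIV
      (\<lambda>i. (x (k + 1) - r + c *\<^sub>R mult_U_transpose U (q (int (k + 1)))) $ i))\<^sup>2)"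
  proof (rule o_inverse_k_bounded_by[OF rate])
    fix k
    have "x (k + 1) - r + c *\<^sub>R mult_U_transpose U (q (int (k + 1))) = - M (s (Suc k) - s k)"
      using step[of k] dual_sequence_mult_U_transpose[OF assms(17), of "Suc k"]
      by (simp add: \<sigma>_def L)
    then have "(frobenius_norm UNIV
      (\<lambda>i. (x (k + 1) - r + c *\<^sub>R mult_U_transpose U (q (int (k + 1)))) $ i))\<^sup>2
      = (norm (M (s (Suc k) - s k)))\<^sup>2"
      unfolding frobenius_norm_UNIV by simp
    also have "\<dots> \<le> K * ((s (Suc k) - s k) \<bullet> M (s (Suc k) - s k))" by (rule K(2))
    also have "\<dots> \<le> K * D k" using K(1) DM by (intro mult_left_mono) auto
    finally show "(frobenius_norm UNIV
      (\<lambda>i. (x (k + 1) - r + c *\<^sub>R mult_U_transpose U (q (int (k + 1)))) $ i))\<^sup>2 \<le> K * D k" .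
  qed simp
  ultimately show ?thesis ..
qed

end
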